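(* Assume that the inexact local reduction algorithm (described in the context) finished with scenario set $\mathbb{H}^*=\{(\mathbf w^1,d^1),\dots,(\mathbf w^H,d^H)\}$, $\operatorname{card}\mathbb{H}^*=H$, and parameters $(\mathbf q^*,r^*,\gamma^* )$. Let $(\mathbf w^*,d^* )\in(\mathbb{W}^N\times\mathbb{D})\setminus\mathbb{H}^*$ be a scenario, and put $$\epsilon_w^*:=\max_{i=1,\dots,H}\|\mathbf w^i-\mathbf w^*\|_2^2,\qquad \epsilon_d^*:=\max_{i=1,\dots,H}\|d^i-d^*\|_2^2 .$$ Let $\varsigma_w>0$ bound $\|(\mathbf w^i,d^i)\|_2$, $i=1,\dots,H$, and $\|(\mathbf w^*,d^* )\|_2$, and let $\varsigma_z>0$ be the bound associated with $\varsigma_w$ by BIBO stability of the trajectories for $(\mathbf q^*,r^* )$ (see context). Then the constraint violation for scenario $(\mathbf w^*,d^* )$ is bounded as follows: for each $k=0,\dots,N-1$ and each $i=1,\dots,H$, $$\|g_k(z_k^i,w_k^i,d^i)-g_k(z_k^*,w_k^*,d^* )\|_2^2\le L^2\big(\epsilon_w^*+\epsilon_d^*+4\varsigma_z^2\big),$$ where $z_k^i=(x_k^i,u_k^i)$ and $z_k^*=(x_k^*,u_k^* )$ are the values at time $k$ of $\mathbf z(\mathbf q^*,r^*,\mathbf w^i,d^i)$ and $\mathbf z(\mathbf q^*,r^*,\mathbf w^*,d^* )$, and $L$ is a local Lipschitz constant of $g_k$ for the given $k$, i.e. a Lipschitz constant (in the Euclidean norm) of $g_k$ on a set containing the points $(z_k^i,w_k^i,d^i)$,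 $i=1,\dots,H$, and $(z_k^*,w_k^*,d^* )$.
   Context: Setting. $N\ge 1$ is an integer horizon; $\mathbb{W}\subset\mathbb{R}^{n_w}$, $\mathbb{D}\subset\mathbb{R}^{n_d}$ are nonempty compact sets. The system is $x_{k+1}=f_k(x_k,u_k,w_k,d)$, $x_0=\hat x$ (given), with $x_k\in\mathbb{R}^{n_x}$, $u_k\in\mathbb{R}^{n_u}$, $w_k\in\mathbb{W}$, $d\in\mathbb{D}$, $f_k$ continuously differentiable, and control given by a causal feedback policy $u_k=\pi_k(x_0,\dots,x_k;q_0,\dots,q_k,r)$ with parameters $\mathbf q=(q_0,\dots,q_{N-1})\in\mathbb{R}^{n_q}$, $r\in\mathbb{R}^{n_r}$. Write $\mathbf x=(x_0,\dots,x_N)$, $\mathbf u=(u_0,\dots,u_{N-1})$, $\mathbf w=(w_0,\dots,w_{N-1})\in\mathbb{W}^N$. $\mathbf z(\mathbf q,r,\mathbf w,d)$ denotes the unique trajectory $(\mathbf x,\mathbf u)$ satisfying these relations for $k=0,\dots,N-1$; it is assumed bounded over the finite horizon. A scenario is an element $(\mathbf w,d)\in\mathbb{W}^N\times\mathbb{D}$. Cost: $J_N(\mathbf x,\mathbf u,\mathbf w,d)=J_f(x_N,\mathbf w,d)+\sum_{k=0}^{N-1}\ell_k(x_k,u_k,w_k,d)$ with $J_f,\ell_k$ continuously differentiable. Constraints: $g_k(x_k,u_k,w_k,d)\le0$ (componentwise), $g_k$ continuously differentiable with values in $\mathbb{R}^{n_g}$, $k=0,\dots,N-1$. With $e_h$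 the $h$-th column of the $n_g\times n_g$ identity matrix, $$G(\mathbf x,\mathbf u,\mathbf w,d,\gamma):=\max\Big\{\max_{1\le h\le n_g,\ 0\le k\le N-1} e_h^{T}g_k(x_k,u_k,w_k,d),\ J_N(\mathbf x,\mathbf u,\mathbf w,d)-\gamma\Big\}.$$ $\mathcal{P}_N(\mathbb{H})$ is the problem of minimizing $\gamma$ over $(\mathbf q,r,\gamma)$ subject to $G(\mathbf z(\mathbf q,r,\mathbf w,d),\mathbf w,d,\gamma)\le0$ for all $(\mathbf w,d)\in\mathbb{H}$, and $G_{\max}(\mathbf q,r,\gamma,\mathbb{H}):=\max_{(\mathbf w,d)\in\mathbb{H}}G(\mathbf z(\mathbf q,r,\mathbf w,d),\mathbf w,d,\gamma)$. Inexact local reduction algorithm. Given tolerances $\epsilon_w,\epsilon_d\ge0$, two scenarios are similar if $\frac1N\|\mathbf w^1-\mathbf w^2\|_2^2\le\epsilon_w$ and $\|d^1-d^2\|_2^2\le\epsilon_d$. Start with a finite nonempty scenario set $\mathbb{H}_1$ and an initial guess $(\mathbf q^1,r^1,\gamma^1)$. For $j=1,2,\dots$: compute (possibly only with a local solver) $G_{\max}(\mathbf q^j,r^j,\gamma^j,\mathbb{W}^N\times\mathbb{D})$ and a maximizing scenario $(\mathbf w^j,d^j)$. If the value is $\le0$, set $\mathbb{H}_{j+1}=\mathbb{H}_j$ and keep the current parameters. Otherwise, set $\mathbb{H}_{j+1}=\mathbb{H}_j\cup\{(\mathbf w^j,d^j)\}$ if $(\mathbf w^j,d^j)$ is not similar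 to any scenario in $\mathbb{H}_j$, and $\mathbb{H}_{j+1}=\mathbb{H}_j$ if it is; then let $(\mathbf q^{j+1},r^{j+1},\gamma^{j+1})$ solve $\mathcal{P}_N(\mathbb{H}_{j+1})$. Stop when the cardinality of the scenario set does not change, and return the current parameters as $(\mathbf q^*,r^*,\gamma^* )$ and the current scenario set as $\mathbb{H}^*$. BIBO stability assumption: for the chosen parameters $(\mathbf q^*,r^* )$, for every $\varsigma_w>0$ there exists $\varsigma_z>0$ such that every scenario with $\|(\mathbf w,d)\|_2\le\varsigma_w$ satisfies $\|\mathbf z(\mathbf q^*,r^*,\mathbf w,d)\|_2\le\varsigma_z$. *)

theory Defs
  imports "HOL-Analysis.Analysis"
begin

text \<open>
  Problem data. The horizon \<open>N\<close> is the cardinality of the index type \<open>'h\<close>, so that disturbance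
  sequences \<open>(w_0, \<dots>, w_{N-1})\<close> live in the Euclidean space \<^typ>\<open>real^'nw^'h\<close>.
  The parameter vector \<open>q = (q_0, \<dots>, q_{N-1})\<close> is a single vector in \<^typ>\<open>real^'nq\<close>;
  \<open>block\<close> tells which \<open>q_k\<close> a coordinate belongs to, so the \<open>q_k\<close> may have different sizes.
  The policy formally receives the whole state sequence and all of \<open>q\<close>; causality is imposed below.
\<close>

record ('nx, 'nu, 'nw, 'nd, 'nq, 'nr, 'ng, 'h) ocp =
  dist_set :: "(real^'nw) set"
  par_set :: "(real^'nd) set"
  init :: "real^'nx"
  dyn :: "nat \<Rightarrow> (real^'nx) \<times> (real^'nu) \<times> (real^'nw) \<times> (real^'nd) \<Rightarrow> real^'nx"
  block :: "'nq \<Rightarrow> nat"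
  policy :: "nat \<Rightarrow> (nat \<Rightarrow> real^'nx) \<Rightarrow> real^'nq \<Rightarrow> real^'nr \<Rightarrow> real^'nu"
  stage_cost :: "nat \<Rightarrow> (real^'nx) \<times> (real^'nu) \<times> (real^'nw) \<times> (real^'nd) \<Rightarrow> real"
  final_cost :: "(real^'nx) \<times> (real^'nw^'h) \<times> (real^'nd) \<Rightarrow> real"
  constr :: "nat \<Rightarrow> (real^'nx) \<times> (real^'nu) \<times> (real^'nw) \<times> (real^'nd) \<Rightarrow> real^'ng"

type_synonym ('nw, 'nd, 'h) scenario = "(real^'nw^'h) \<times> (real^'nd)"

text \<open>States are indexed by \<open>0, \<dots>, N\<close>: a function on \<open>nat\<close>, extensional outside \<open>{..N}\<close>.\<close>

type_synonym ('nx, 'nu, 'h) traj = "(nat \<Rightarrow> real^'nx) \<times> (real^'nu^'h)"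

type_synonym ('nq, 'nr) param = "(real^'nq) \<times> (real^'nr) \<times> real"

definition horizon ::
  "('nx::finite, 'nu::finite, 'nw::finite, 'nd::finite, 'nq::finite, 'nr::finite, 'ng::finite, 'h::finite) ocp \<Rightarrow> nat"
  where "horizon P = CARD('h)"

text \<open>The library's fixed enumeration of \<open>'h\<close>, a bijection from \<open>{..<N}\<close>, serves as time axis.\<close>

definition at_time :: "'a^'h::finite \<Rightarrow> nat \<Rightarrow> 'a"
  where "at_time v k = v $ from_nat_into (UNIV :: 'h set) k"

definition scenarios ::
  "('nx::finite, 'nu::finite, 'nw::finite, 'nd::finite, 'nq::finite, 'nr::finite, 'ng::finite, 'h::finite) ocp
    \<Rightarrow> ('nw, 'nd, 'h) scenario set"
  where "scenarios P = {w. \<forall>i. w $ i \<in> dist_set P} \<times> par_set P"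

definition is_traj ::
  "('nx::finite, 'nu::finite, 'nw::finite, 'nd::finite, 'nq::finite, 'nr::finite, 'ng::finite, 'h::finite) ocp
    \<Rightarrow> real^'nq \<Rightarrow> real^'nr \<Rightarrow> ('nw, 'nd, 'h) scenario \<Rightarrow> ('nx, 'nu, 'h) traj \<Rightarrow> bool"
  where "is_traj P q r = (\<lambda>(w, d) (x, u).
    x \<in> extensional {..horizon P} \<and> x 0 = init P \<and>
    (\<forall>k<horizon P. at_time u k = policy P k x q r \<and>
                   x (Suc k) = dyn P k (x k, at_time u k, at_time w k, d)))"

text \<open>Existence and uniqueness, which justify the description operator, are proved below.\<close>

definition trajectory ::
  "('nx::finite, 'nu::finite, 'nw::finite, 'nd::finite, 'nq::finite, 'nr::finite, 'ng::finite, 'h::finite) ocp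
    \<Rightarrow> real^'nq \<Rightarrow> real^'nr \<Rightarrow> ('nw, 'nd, 'h) scenario \<Rightarrow> ('nx, 'nu, 'h) traj"
  where "trajectory P q r s = (THE z. is_traj P q r s z)"

definition traj_norm ::
  "('nx::finite, 'nu::finite, 'nw::finite, 'nd::finite, 'nq::finite, 'nr::finite, 'ng::finite, 'h::finite) ocp
    \<Rightarrow> ('nx, 'nu, 'h) traj \<Rightarrow> real"
  where "traj_norm P = (\<lambda>(x, u). sqrt ((\<Sum>k\<le>horizon P. (norm (x k))\<^sup>2) + (norm u)\<^sup>2))"

text \<open>The tuple \<open>(z_k, w_k, d) = (x_k, u_k, w_k, d)\<close> along the trajectory of a scenario.\<close>

definition stage_point ::
  "('nx::finite, 'nu::finite, 'nw::finite, 'nd::finite, 'nq::finite, 'nr::finite, 'ng::finite, 'h::finite) ocp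
    \<Rightarrow> real^'nq \<Rightarrow> real^'nr \<Rightarrow> ('nw, 'nd, 'h) scenario \<Rightarrow> nat
    \<Rightarrow> (real^'nx) \<times> (real^'nu) \<times> (real^'nw) \<times> (real^'nd)"
  where "stage_point P q r s k =
    (let (w, d) = s; (x, u) = trajectory P q r s in (x k, at_time u k, at_time w k, d))"

definition causal_policy ::
  "('nx::finite, 'nu::finite, 'nw::finite, 'nd::finite, 'nq::finite, 'nr::finite, 'ng::finite, 'h::finite) ocp \<Rightarrow> bool"
  where "causal_policy P \<longleftrightarrow> (\<forall>k<horizon P. \<forall>x x' q q' r.
    (\<forall>i\<le>k. x i = x' i) \<and> (\<forall>b. block P b \<le> k \<longrightarrow> q $ b = q' $ b)
      \<longrightarrow> policy P k x q r = policy P k x' q' r)"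

text \<open>Continuous differentiability on (an open neighbourhood of) \<open>S\<close>; for \<open>S = UNIV\<close> the usual notion.\<close>

definition C1_on :: "'a::real_normed_vector set \<Rightarrow> ('a \<Rightarrow> 'b::real_normed_vector) \<Rightarrow> bool"
  where "C1_on S f \<longleftrightarrow> (\<exists>U (f' :: 'a \<Rightarrow> 'a \<Rightarrow>\<^sub>L 'b). open U \<and> S \<subseteq> U \<and>
    (\<forall>x\<in>U. (f has_derivative blinfun_apply (f' x)) (at x)) \<and> continuous_on U f')"

text \<open>
  The standing assumptions. \<open>N \<ge> 1\<close> holds because types are nonempty. The last clause (every
  trajectory is bounded over the finite horizon) is automatic for a discrete-time system.
\<close>

definition standing_assumptions ::
  "('nx::finite, 'nu::finite, 'nw::finite, 'nd::finite, 'nq::finite, 'nr::finite, 'ng::finite, 'h::finite) ocp \<Rightarrow> bool"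
  where "standing_assumptions P \<longleftrightarrow>
    compact (dist_set P) \<and> dist_set P \<noteq> {} \<and> compact (par_set P) \<and> par_set P \<noteq> {} \<and>
    (\<forall>b. block P b < horizon P) \<and> causal_policy P \<and>
    (\<forall>k<horizon P. C1_on (UNIV \<times> UNIV \<times> dist_set P \<times> par_set P) (dyn P k)) \<and>
    (\<forall>k<horizon P. C1_on (UNIV \<times> UNIV \<times> dist_set P \<times> par_set P) (stage_cost P k)) \<and>
    (\<forall>k<horizon P. C1_on (UNIV \<times> UNIV \<times> dist_set P \<times> par_set P) (constr P k)) \<and>
    C1_on (UNIV \<times> scenarios P) (final_cost P) \<and>
    (\<forall>q r. \<forall>s\<in>scenarios P. \<exists>B. traj_norm P (trajectory P q r s) \<le> B)"

definition total_cost ::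
  "('nx::finite, 'nu::finite, 'nw::finite, 'nd::finite, 'nq::finite, 'nr::finite, 'ng::finite, 'h::finite) ocp
    \<Rightarrow> ('nx, 'nu, 'h) traj \<Rightarrow> ('nw, 'nd, 'h) scenario \<Rightarrow> real"
  where "total_cost P = (\<lambda>(x, u) (w, d). final_cost P (x (horizon P), w, d) +
    (\<Sum>k<horizon P. stage_cost P k (x k, at_time u k, at_time w k, d)))"

definition G ::
  "('nx::finite, 'nu::finite, 'nw::finite, 'nd::finite, 'nq::finite, 'nr::finite, 'ng::finite, 'h::finite) ocp
    \<Rightarrow> ('nx, 'nu, 'h) traj \<Rightarrow> ('nw, 'nd, 'h) scenario \<Rightarrow> real \<Rightarrow> real"
  where "G P = (\<lambda>(x, u) (w, d) \<gamma>. max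
    (Max {constr P k (x k, at_time u k, at_time w k, d) $ h | h k. k < horizon P})
    (total_cost P (x, u) (w, d) - \<gamma>))"

definition G_closed ::
  "('nx::finite, 'nu::finite, 'nw::finite, 'nd::finite, 'nq::finite, 'nr::finite, 'ng::finite, 'h::finite) ocp
    \<Rightarrow> ('nq, 'nr) param \<Rightarrow> ('nw, 'nd, 'h) scenario \<Rightarrow> real"
  where "G_closed P = (\<lambda>(q, r, \<gamma>) s. G P (trajectory P q r s) s \<gamma>)"

definition solves_scenario_problem ::
  "('nx::finite, 'nu::finite, 'nw::finite, 'nd::finite, 'nq::finite, 'nr::finite, 'ng::finite, 'h::finite) ocp
    \<Rightarrow> ('nw, 'nd, 'h) scenario set \<Rightarrow> ('nq, 'nr) param \<Rightarrow> bool"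
  where "solves_scenario_problem P H p \<longleftrightarrow>
    is_arg_min (\<lambda>(q, r, \<gamma>). \<gamma>) (\<lambda>p'. \<forall>s\<in>H. G_closed P p' s \<le> 0) p"

text \<open>
  Outcome of the (possibly only local) maximization over scenarios. A global maximizer is in
  particular a local one; at a global maximizer the value is \<open>G\<^sub>m\<^sub>a\<^sub>x\<close>.
\<close>

definition local_maximizer :: "('a::topological_space \<Rightarrow> real) \<Rightarrow> 'a set \<Rightarrow> 'a \<Rightarrow> bool"
  where "local_maximizer \<phi> S s \<longleftrightarrow> s \<in> S \<and> (\<forall>\<^sub>F t in at s within S. \<phi> t \<le> \<phi> s)"

definition similar ::
  "real \<Rightarrow> real \<Rightarrow> ('nw::finite, 'nd::finite, 'h::finite) scenario \<Rightarrow> ('nw, 'nd, 'h) scenario \<Rightarrow> bool"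
  where "similar \<epsilon>w \<epsilon>d = (\<lambda>(w1, d1) (w2, d2).
    1 / real CARD('h) * (norm (w1 - w2))\<^sup>2 \<le> \<epsilon>w \<and> (norm (d1 - d2))\<^sup>2 \<le> \<epsilon>d)"

text \<open>One pass \<open>(H, p) \<mapsto> (H', p')\<close> through the loop body of the inexact local reduction algorithm.\<close>

definition reduction_step ::
  "('nx::finite, 'nu::finite, 'nw::finite, 'nd::finite, 'nq::finite, 'nr::finite, 'ng::finite, 'h::finite) ocp
    \<Rightarrow> real \<Rightarrow> real \<Rightarrow> ('nw, 'nd, 'h) scenario set \<Rightarrow> ('nq, 'nr) param
    \<Rightarrow> ('nw, 'nd, 'h) scenario set \<Rightarrow> ('nq, 'nr) param \<Rightarrow> bool"
  where "reduction_step P \<epsilon>w \<epsilon>d H p H' p' \<longleftrightarrow>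
    (\<exists>s. local_maximizer (G_closed P p) (scenarios P) s \<and>
      (if G_closed P p s \<le> 0 then H' = H \<and> p' = p
       else H' = (if \<exists>t\<in>H. similar \<epsilon>w \<epsilon>d s t then H else H \<union> {s}) \<and>
            solves_scenario_problem P H' p'))"

text \<open>Loop states reached from \<open>(H1, p1)\<close> without having met the stopping criterion.\<close>

inductive reduction_reaches ::
  "('nx::finite, 'nu::finite, 'nw::finite, 'nd::finite, 'nq::finite, 'nr::finite, 'ng::finite, 'h::finite) ocp
    \<Rightarrow> real \<Rightarrow> real \<Rightarrow> ('nw, 'nd, 'h) scenario set \<Rightarrow> ('nq, 'nr) param
    \<Rightarrow> ('nw, 'nd, 'h) scenario set \<Rightarrow> ('nq, 'nr) param \<Rightarrow> bool"
  for P \<epsilon>w \<epsilon>d H1 p1 where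
    start: "finite H1 \<Longrightarrow> H1 \<noteq> {} \<Longrightarrow> H1 \<subseteq> scenarios P \<Longrightarrow> reduction_reaches P \<epsilon>w \<epsilon>d H1 p1 H1 p1"
  | continue: "reduction_reaches P \<epsilon>w \<epsilon>d H1 p1 H p \<Longrightarrow> reduction_step P \<epsilon>w \<epsilon>d H p H' p' \<Longrightarrow>
      card H' \<noteq> card H \<Longrightarrow> reduction_reaches P \<epsilon>w \<epsilon>d H1 p1 H' p'"

definition reduction_returns ::
  "('nx::finite, 'nu::finite, 'nw::finite, 'nd::finite, 'nq::finite, 'nr::finite, 'ng::finite, 'h::finite) ocp
    \<Rightarrow> real \<Rightarrow> real \<Rightarrow> ('nw, 'nd, 'h) scenario set \<Rightarrow> ('nq, 'nr) param
    \<Rightarrow> ('nw, 'nd, 'h) scenario set \<Rightarrow> ('nq, 'nr) param \<Rightarrow> bool"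
  where "reduction_returns P \<epsilon>w \<epsilon>d H1 p1 H' p' \<longleftrightarrow>
    (\<exists>H p. reduction_reaches P \<epsilon>w \<epsilon>d H1 p1 H p \<and> reduction_step P \<epsilon>w \<epsilon>d H p H' p' \<and>
           card H' = card H)"

definition bibo_bound ::
  "('nx::finite, 'nu::finite, 'nw::finite, 'nd::finite, 'nq::finite, 'nr::finite, 'ng::finite, 'h::finite) ocp
    \<Rightarrow> real^'nq \<Rightarrow> real^'nr \<Rightarrow> real \<Rightarrow> real \<Rightarrow> bool"
  where "bibo_bound P q r \<sigma>w \<sigma>z \<longleftrightarrow>
    (\<forall>s\<in>scenarios P. norm s \<le> \<sigma>w \<longrightarrow> traj_norm P (trajectory P q r s) \<le> \<sigma>z)"

definition bibo_stable ::
  "('nx::finite, 'nu::finite, 'nw::finite, 'nd::finite, 'nq::finite, 'nr::finite, 'ng::finite, 'h::finite) ocp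
    \<Rightarrow> real^'nq \<Rightarrow> real^'nr \<Rightarrow> bool"
  where "bibo_stable P q r \<longleftrightarrow> (\<forall>\<sigma>w>0. \<exists>\<sigma>z>0. bibo_bound P q r \<sigma>w \<sigma>z)"

lemma bij_betw_time: "bij_betw (from_nat_into (UNIV :: 'h::finite set)) {..<CARD('h)} UNIV"
  by (rule bij_betw_from_nat_into_finite) simp

lemma causal_policyD:
  assumes "causal_policy P" "k < horizon P" "\<And>i. i \<le> k \<Longrightarrow> x i = x' i"
  shows "policy P k x q r = policy P k x' q r"
  using assms unfolding causal_policy_def by blast

theorem trajectory_ex1:
  fixes P :: "('nx::finite, 'nu::finite, 'nw::finite, 'nd::finite, 'nq::finite, 'nr::finite, 'ng::finite, 'h::finite) ocp"
  assumes causal: "causal_policy P"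
  shows "\<exists>!z. is_traj P q r s z"
proof -
  obtain w d where s: "s = (w, d)" by (cases s)
  let ?N = "horizon P"
  let ?t = "from_nat_into (UNIV :: 'h set)"
  define X where "X = rec_nat (\<lambda>_. init P)
    (\<lambda>n X. X(Suc n := dyn P n (X n, policy P n X q r, at_time w n, d)))"
  have X0: "X 0 = (\<lambda>_. init P)" and
    XS: "X (Suc n) = (X n)(Suc n := dyn P n (X n n, policy P n (X n) q r, at_time w n, d))" for n
    by (simp_all add: X_def)
  have agree: "k \<le> n \<Longrightarrow> X n k = X k k" for n k
    by (induction n) (auto simp: XS le_Suc_eq)
  define x where "x = restrict (\<lambda>k. X k k) {..?N}"
  define u :: "real^'nu^'h" where "u = (\<chi> i. policy P (inv_into {..<?N} ?t i) x q r)"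
  have pol: "policy P k x q r = policy P k (X k) q r" if "k < ?N" for k
    by (rule causal_policyD[OF causal that]) (use that agree[of _ k, symmetric] in \<open>simp add: x_def\<close>)
  have u: "at_time u k = policy P k x q r" if "k < ?N" for k
  proof -
    have "inv_into {..<?N} ?t (?t k) = k"
      using that bij_betw_time[where 'h='h] by (simp add: horizon_def bij_betw_def)
    then show ?thesis by (simp add: at_time_def u_def)
  qed
  have "is_traj P q r s (x, u)"
    unfolding is_traj_def s
  proof (clarsimp, intro conjI allI impI)
    show "x \<in> extensional {..?N}" by (simp add: x_def)
    show "x 0 = init P" by (simp add: x_def X0)
    fix k assume k: "k < ?N"
    show "at_time u k = policy P k x q r" by (rule u[OF k])
    show "x (Suc k) = dyn P k (x k, at_time u k, at_time w k, d)"
      using k by (simp add: u pol) (simp add: x_def XS)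
  qed
  moreover have "z = z'" if z: "is_traj P q r s z" and z': "is_traj P q r s z'" for z z'
  proof -
    obtain a b a' b' where ab: "z = (a, b)" "z' = (a', b')" by (cases z, cases z')
    have A: "a \<in> extensional {..?N}" "a 0 = init P"
      "\<And>k. k < ?N \<Longrightarrow> at_time b k = policy P k a q r"
      "\<And>k. k < ?N \<Longrightarrow> a (Suc k) = dyn P k (a k, at_time b k, at_time w k, d)"
      using z by (simp_all add: is_traj_def s ab)
    have A': "a' \<in> extensional {..?N}" "a' 0 = init P"
      "\<And>k. k < ?N \<Longrightarrow> at_time b' k = policy P k a' q r"
      "\<And>k. k < ?N \<Longrightarrow> a' (Suc k) = dyn P k (a' k, at_time b' k, at_time w k, d)"
      using z' by (simp_all add: is_traj_def s ab)
    have eq: "k \<le> ?N \<Longrightarrow> \<forall>j\<le>k. a j = a' j" for k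
    proof (induction k)
      case 0 then show ?case by (simp add: A A')
    next
      case (Suc k)
      then have IH: "\<forall>j\<le>k. a j = a' j" by simp
      then have "policy P k a q r = policy P k a' q r"
        using Suc.prems by (intro causal_policyD[OF causal]) auto
      then have "a (Suc k) = a' (Suc k)" using Suc.prems IH by (simp add: A A')
      with IH show ?case by (simp add: le_Suc_eq)
    qed
    have aa: "a = a'"
      using A(1) A'(1) eq[of ?N] by (intro extensionalityI[where A="{..?N}"]) auto
    have "b $ i = b' $ i" for i
    proof -
      have "i \<in> ?t ` {..<?N}"
        using bij_betw_time[where 'h='h] by (simp add: horizon_def bij_betw_def)
      then obtain k where "k < ?N" "i = ?t k" by auto
      then show ?thesis using A(3)[of k] A'(3)[of k] aa by (simp add: at_time_def)
    qed
    then show ?thesis by (simp add: ab aa vec_eq_iff)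
  qed
  ultimately show ?thesis by blast
qed

end

theory Submission
  imports Defs
begin

text \<open>The product norm is Euclidean, so the squared distance of two stage points is the sum of
  the squared distances of their \<open>(x_k, u_k)\<close>, \<open>w_k\<close> and \<open>d\<close>
  parts. The last two are at most the squared distances of the whole disturbance sequences and
  parameters, hence at most the maxima in the claim. Both trajectories lie in the ball of radius
  \<sigma>z, so the first is at most (2 \<sigma>z)^2. This is \<open>stage_point_dist_le\<close>;
  the Lipschitz estimate, squared, finishes. The algorithm enters only through
  \<open>reduction_returns_scenarios\<close>: the returned set consists of admissible scenarios, to
  which the BIBO bound applies.\<close>

lemma norm_at_time_le: "norm (at_time v k) \<le> norm v"
  by (simp add: at_time_def Finite_Cartesian_Product.norm_nth_le)

lemma at_time_diff: "at_time v k - at_time v' k = at_time (v - v') k"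
  by (simp add: at_time_def)

text \<open>The pair at time \<open>k\<close> picks one summand of the state sum and one component
  of \<open>u\<close>, so its square is a partial sum of the squared trajectory norm.\<close>

lemma stage_norm_le_traj_norm:
  assumes "k \<le> horizon P"
  shows "norm (x k, at_time u k) \<le> traj_norm P (x, u)"
proof -
  have "(norm (x k))\<^sup>2 \<le> (\<Sum>k\<le>horizon P. (norm (x k))\<^sup>2)"
    using assms by (intro member_le_sum) auto
  then show ?thesis
    by (simp add: norm_Pair traj_norm_def add_mono norm_at_time_le)
qed

text \<open>The trajectory parts are compared only through the triangle inequality, by way of their
  common bound; this is the source of the term \<open>4 * \<sigma>\<^sup>2\<close>, which persists
  even for close scenarios.\<close>

lemma stage_point_dist_le:
  assumes k: "k \<le> horizon P"
    and s: "traj_norm P (trajectory P q r (w, d)) \<le> \<sigma>"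
    and s': "traj_norm P (trajectory P q r (w', d')) \<le> \<sigma>"
  shows "(norm (stage_point P q r (w, d) k - stage_point P q r (w', d') k))\<^sup>2
    \<le> (norm (w - w'))\<^sup>2 + (norm (d - d'))\<^sup>2 + 4 * \<sigma>\<^sup>2"
proof -
  obtain x u x' u' where z: "trajectory P q r (w, d) = (x, u)" "trajectory P q r (w', d') = (x', u')"
    by (metis surj_pair)
  let ?z = "(x k, at_time u k)" and ?z' = "(x' k, at_time u' k)"
  have "norm ?z \<le> \<sigma>" "norm ?z' \<le> \<sigma>"
    using stage_norm_le_traj_norm[OF k] s s' unfolding z by (meson order_trans)+
  then have "norm (?z - ?z') \<le> 2 * \<sigma>"
    using norm_triangle_ineq4[of ?z ?z'] by linarith
  then have "(norm (?z - ?z'))\<^sup>2 \<le> 4 * \<sigma>\<^sup>2"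
    using power_mono[OF _ norm_ge_zero, of "?z - ?z'" "2 * \<sigma>" 2] by (simp add: power_mult_distrib)
  moreover have "(norm (at_time (w - w') k))\<^sup>2 \<le> (norm (w - w'))\<^sup>2"
    by (simp add: norm_at_time_le power_mono)
  \<comment> \<open>Pythagoras for the nested pairs: an exact equality, so no constant is lost
    here.\<close>
  moreover have "(norm (stage_point P q r (w, d) k - stage_point P q r (w', d') k))\<^sup>2
    = (norm (?z - ?z'))\<^sup>2 + (norm (at_time (w - w') k))\<^sup>2 + (norm (d - d'))\<^sup>2"
    by (simp add: stage_point_def z norm_Pair at_time_diff)
  ultimately show ?thesis by linarith
qed

text \<open>The only scenario a pass can add is a local maximizer over \<open>scenarios P\<close>,
  which lies in that set by definition.\<close>

lemma reduction_step_scenarios: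
  assumes "reduction_step P \<epsilon>w \<epsilon>d H p H' p'" "H \<subseteq> scenarios P"
  shows "H' \<subseteq> scenarios P"
  using assms by (auto simp: reduction_step_def local_maximizer_def split: if_splits)

lemma reduction_reaches_scenarios:
  "reduction_reaches P \<epsilon>w \<epsilon>d H1 p1 H p \<Longrightarrow> H \<subseteq> scenarios P"
  by (induction rule: reduction_reaches.induct) (auto dest: reduction_step_scenarios)

lemma reduction_returns_scenarios:
  "reduction_returns P \<epsilon>w \<epsilon>d H1 p1 H p \<Longrightarrow> H \<subseteq> scenarios P"
  unfolding reduction_returns_def
  by (blast dest: reduction_reaches_scenarios reduction_step_scenarios)

theorem theorem3p4:
  fixes P :: "('nx::finite, 'nu::finite, 'nw::finite, 'nd::finite, 'nq::finite, 'nr::finite, 'ng::finite, 'h::finite) ocp"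
    and H1 Hstar :: "('nw, 'nd, 'h) scenario set"
    and p1 :: "('nq, 'nr) param"
    and qstar :: "real^'nq" and rstar :: "real^'nr" and \<gamma>star :: real
    and w :: "nat \<Rightarrow> real^'nw^'h" and d :: "nat \<Rightarrow> real^'nd"
    and wstar :: "real^'nw^'h" and dstar :: "real^'nd"
    and \<epsilon>w \<epsilon>d \<epsilon>wstar \<epsilon>dstar \<sigma>w \<sigma>z L :: real
    and H i k :: nat
    and S :: "((real^'nx) \<times> (real^'nu) \<times> (real^'nw) \<times> (real^'nd)) set"
  assumes "standing_assumptions P"
    and "\<epsilon>w \<ge> 0" and "\<epsilon>d \<ge> 0"
    and "reduction_returns P \<epsilon>w \<epsilon>d H1 p1 Hstar (qstar, rstar, \<gamma>star)"
    and "Hstar = (\<lambda>i. (w i, d i)) ` {1..H}" and "card Hstar = H"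
    and "(wstar, dstar) \<in> scenarios P - Hstar"
    and "\<epsilon>wstar = Max ((\<lambda>i. (norm (w i - wstar))\<^sup>2) ` {1..H})"
    and "\<epsilon>dstar = Max ((\<lambda>i. (norm (d i - dstar))\<^sup>2) ` {1..H})"
    and "bibo_stable P qstar rstar"
    and "\<sigma>w > 0" and "\<forall>i\<in>{1..H}. norm (w i, d i) \<le> \<sigma>w" and "norm (wstar, dstar) \<le> \<sigma>w"
    and "\<sigma>z > 0" and "bibo_bound P qstar rstar \<sigma>w \<sigma>z"
    and "k < horizon P" and "i \<in> {1..H}"
    and "\<forall>j\<in>{1..H}. stage_point P qstar rstar (w j, d j) k \<in> S"
    and "stage_point P qstar rstar (wstar, dstar) k \<in> S"
    and "L-lipschitz_on S (constr P k)"
  shows "(norm (constr P k (stage_point P qstar rstar (w i, d i) k)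
              - constr P k (stage_point P qstar rstar (wstar, dstar) k)))\<^sup>2
         \<le> L\<^sup>2 * (\<epsilon>wstar + \<epsilon>dstar + 4 * \<sigma>z\<^sup>2)"
proof -
  let ?p = "stage_point P qstar rstar (w i, d i) k"
  let ?p' = "stage_point P qstar rstar (wstar, dstar) k"
  \<comment> \<open>\<open>bibo_bound\<close> speaks of admissible scenarios only, so membership
    comes before the trajectory bound.\<close>
  have "(w i, d i) \<in> scenarios P"
    using reduction_returns_scenarios[OF assms(4)] assms(5,17) by blast
  then have B: "traj_norm P (trajectory P qstar rstar (w i, d i)) \<le> \<sigma>z"
    using assms(12,15,17) by (auto simp: bibo_bound_def)
  have B': "traj_norm P (trajectory P qstar rstar (wstar, dstar)) \<le> \<sigma>z"
    using assms(7,13,15) by (auto simp: bibo_bound_def)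
  have "(norm (w i - wstar))\<^sup>2 \<le> \<epsilon>wstar" "(norm (d i - dstar))\<^sup>2 \<le> \<epsilon>dstar"
    using assms(8,9,17) by (auto intro!: Max_ge)
  then have "(norm (?p - ?p'))\<^sup>2 \<le> \<epsilon>wstar + \<epsilon>dstar + 4 * \<sigma>z\<^sup>2"
    using stage_point_dist_le[OF less_imp_le[OF assms(16)] B B'] by linarith
  then have "L\<^sup>2 * (norm (?p - ?p'))\<^sup>2 \<le> L\<^sup>2 * (\<epsilon>wstar + \<epsilon>dstar + 4 * \<sigma>z\<^sup>2)"
    by (intro mult_left_mono) auto
  moreover have "norm (constr P k ?p - constr P k ?p') \<le> L * norm (?p - ?p')"
    using lipschitz_onD[OF assms(20), of ?p ?p'] assms(17-19) by (simp add: dist_norm)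
  \<comment> \<open>Squaring preserves the inequality because its left side is a norm, hence
    nonnegative.\<close>
  then have "(norm (constr P k ?p - constr P k ?p'))\<^sup>2 \<le> L\<^sup>2 * (norm (?p - ?p'))\<^sup>2"
    using power_mono[OF _ norm_ge_zero] by (metis power_mult_distrib)
  ultimately show ?thesis by linarith
qed

end
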